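(* Let $p,q\ge0$ be integers and let $a_1,\dots,a_p,b_1,\dots,b_q$ be non-zero complex numbers with no $b_i$ a non-positive integer. The hypergeometric coefficient $$c(n)=\frac{(a_1)_{n-1}\cdots(a_p)_{n-1}}{(b_1)_{n-1}\cdots(b_q)_{n-1}},\qquad n\ge1,$$ is a completely multiplicative function of $n$ if and only if it is of the form $c(n)=Cn^a$ (for all $n\ge1$) for some $a\in\mathbb{Z}$ and $C\in\mathbb{C}$.
   Context: The ascending factorial is $(c)_0=1$, $(c)_k = c(c+1)\cdots(c+k-1)$. A function $c$ on the positive integers is completely multiplicative if $c(nk)=c(n)c(k)$ for all $n,k\ge1$. *)

theory Defs
  imports Complex_Main "HOL-Library.Nonpos_Ints"
begin

text \<open>Arithmetic functions are total on \<^typ>\<open>nat\<close>; their value at \<open>0\<close> is irrelevant,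
  so only positive arguments are constrained.\<close>

definition completely_multiplicative :: "(nat \<Rightarrow> complex) \<Rightarrow> bool" where
  "completely_multiplicative c \<longleftrightarrow> (\<forall>n\<ge>1. \<forall>k\<ge>1. c (n * k) = c n * c k)"

text \<open>The parameters are \<open>a 1, \<dots>, a p\<close> and \<open>b 1, \<dots>, b q\<close>.\<close>

definition hypergeom_coeff ::
  "nat \<Rightarrow> nat \<Rightarrow> (nat \<Rightarrow> complex) \<Rightarrow> (nat \<Rightarrow> complex) \<Rightarrow> nat \<Rightarrow> complex" where
  "hypergeom_coeff p q a b n =
     (\<Prod>i=1..p. pochhammer (a i) (n - 1)) / (\<Prod>j=1..q. pochhammer (b j) (n - 1))"

end

theory Submission
  imports Defs "HOL-Computational_Algebra.Fundamental_Theorem_Algebra"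
begin

text \<open>
  Powers are completely multiplicative, and \<open>c(1) = 1\<close> forces \<open>C = 1\<close>; the content is the
  converse.

  Put \<open>A = \<Prod>\<^sub>i (X + a\<^sub>i - 1)\<close> and \<open>B = \<Prod>\<^sub>j (X + b\<^sub>j - 1)\<close>, so that
  \<open>c(n + 1) / c(n) = A(n) / B(n)\<close>, and let \<open>R = A / B\<close>. Dividing the relation
  \<open>c(2n) = c(2) c(n)\<close> for \<open>n + 1\<close> by the one for \<open>n\<close> gives \<open>R(2n) R(2n + 1) = R(n)\<close>. Division is
  possible whenever \<open>c(n) \<noteq> 0\<close>, in particular for every power of two, since \<open>c(2\<^sup>k) = c(2)\<^sup>k\<close> and
  \<open>c(2) \<noteq> 0\<close> (this is where \<open>a\<^sub>i \<noteq> 0\<close> enters). So this is an identity of rational functions.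

  Let \<open>d(z)\<close> be the order of \<open>R\<close> at \<open>z\<close>. The identity says \<open>d(z) = d(2z) + d(2z + 1)\<close>, and \<open>d\<close>
  has finite support. The maps \<open>z \<mapsto> 2z\<close> and \<open>z \<mapsto> 2z + 1\<close> drive every point outside the disk
  with diameter \<open>[-1, 0]\<close> away to infinity, while halving a point of the support other than \<open>0\<close>
  and \<open>-1\<close> gives another such point, closer to \<open>0\<close>. A finite set can contain neither an endless
  escape nor an endless halving, so only \<open>0\<close> and \<open>-1\<close>, the fixed points of the two maps, can lie
  in the support (\<open>support_of_doubling_recurrence\<close>). The recurrence at \<open>-1/2\<close> then gives
  \<open>d(-1) + d(0) = 0\<close>. As \<open>A\<close> and \<open>B\<close> are monic, \<open>R = ((X + 1) / X)\<^sup>m\<close> with \<open>m = d(-1)\<close>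
  (\<open>duplication_identity_imp_power\<close>), and the product telescopes to \<open>c(n) = n\<^sup>m\<close>.
\<close>

section \<open>Finitely supported solutions of \<open>d(z) = d(2z) + d(2z + 1)\<close>\<close>

text \<open>
  In the coordinate \<open>u = 2z + 1\<close> the two maps are \<open>u \<mapsto> 2u - 1\<close> and \<open>u \<mapsto> 2u + 1\<close>; both increase
  \<open>\<bar>u\<bar>\<close> when \<open>\<bar>u\<bar> > 1\<close>. A point of the support with largest \<open>\<bar>u\<bar> > 1\<close> would therefore have both
  images outside the support, which contradicts the recurrence.
\<close>

lemma support_of_doubling_recurrence_in_disk:
  fixes d :: "complex \<Rightarrow> int"
  assumes fin: "finite {z. d z \<noteq> 0}"
    and rec: "\<And>z. d z = d (2 * z) + d (2 * z + 1)"
    and "d w \<noteq> 0"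
  shows "cmod (2 * w + 1) \<le> 1"
proof (rule ccontr)
  define g :: "complex \<Rightarrow> real" where "g z = cmod (2 * z + 1)" for z
  assume "\<not> ?thesis"
  then have "g w > 1" by (simp add: g_def)
  let ?S = "{z. d z \<noteq> 0}"
  have "Max (g ` ?S) \<in> g ` ?S" using fin \<open>d w \<noteq> 0\<close> by (intro Max_in) auto
  then obtain x where x: "d x \<noteq> 0" "g x = Max (g ` ?S)" by auto
  have max: "g y \<le> g x" if "d y \<noteq> 0" for y
    unfolding x(2) using fin that by (intro Max_ge) auto
  have "g x > 1" using max[OF \<open>d w \<noteq> 0\<close>] \<open>g w > 1\<close> by simp
  have "2 * g x = cmod (2 * (2 * x + 1))" by (simp only: g_def norm_mult) simp
  also have "2 * (2 * x + 1) = (2 * (2 * x) + 1) + 1" by (simp add: algebra_simps)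
  also have "cmod \<dots> \<le> g (2 * x) + 1"
    unfolding g_def by (rule norm_triangle_le) simp
  finally have "\<not> g (2 * x) \<le> g x" using \<open>g x > 1\<close> by linarith
  then have "d (2 * x) = 0" using max by blast
  have "2 * g x = cmod (2 * (2 * x + 1))" by (simp only: g_def norm_mult) simp
  also have "2 * (2 * x + 1) = (2 * (2 * x + 1) + 1) - 1" by (simp add: algebra_simps)
  also have "cmod \<dots> \<le> g (2 * x + 1) + 1"
    unfolding g_def by (rule order_trans[OF norm_triangle_ineq4]) simp
  finally have "\<not> g (2 * x + 1) \<le> g x" using \<open>g x > 1\<close> by linarith
  then have "d (2 * x + 1) = 0" using max by blast
  with \<open>d (2 * x) = 0\<close> rec[of x] x(1) show False by simp
qed

text \<open>
  For \<open>z \<noteq> -1\<close> in the support, \<open>z + 1\<close> is outside the disk, so the recurrence at \<open>z / 2\<close> reads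
  \<open>d(z / 2) = d(z)\<close>. Hence the support without \<open>0\<close> and \<open>-1\<close> is closed under halving, and it
  cannot have a point of least modulus.
\<close>

lemma support_of_doubling_recurrence:
  fixes d :: "complex \<Rightarrow> int"
  assumes fin: "finite {z. d z \<noteq> 0}"
    and rec: "\<And>z. d z = d (2 * z) + d (2 * z + 1)"
    and "d w \<noteq> 0"
  shows "w = 0 \<or> w = -1"
proof (rule ccontr)
  assume w: "\<not> ?thesis"
  let ?S = "{z. d z \<noteq> 0 \<and> z \<noteq> 0 \<and> z \<noteq> -1}"
  have "finite ?S" by (rule finite_subset[OF _ fin]) auto
  moreover have "?S \<noteq> {}" using w \<open>d w \<noteq> 0\<close> by auto
  ultimately have "Min (cmod ` ?S) \<in> cmod ` ?S" by (intro Min_in) auto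
  then obtain z where z: "d z \<noteq> 0" "z \<noteq> 0" "z \<noteq> -1" "cmod z = Min (cmod ` ?S)"
    by auto
  have min: "cmod z \<le> cmod y" if "y \<in> ?S" for y
    unfolding z(4) using \<open>finite ?S\<close> that by (intro Min_le) auto
  note disk = support_of_doubling_recurrence_in_disk[OF fin rec]
  have "d (z + 1) = 0"
  proof (rule ccontr)
    assume "d (z + 1) \<noteq> 0"
    from disk[OF this] have "cmod (2 * z + 3) \<le> 1" by (simp add: algebra_simps)
    moreover have "cmod (2 * z + 1) \<le> 1" by (rule disk[OF z(1)])
    \<comment> \<open>Two closed unit disks whose centres are at distance 2 meet in one point only.\<close>
    ultimately have "(2 * Re z + 3)\<^sup>2 + (2 * Im z)\<^sup>2 \<le> 1" "(2 * Re z + 1)\<^sup>2 + (2 * Im z)\<^sup>2 \<le> 1"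
      by (simp_all add: cmod_def)
    then have "(2 * Re z + 2)\<^sup>2 + (2 * Im z)\<^sup>2 \<le> 0" by (simp add: power2_eq_square algebra_simps)
    then have "2 * Re z + 2 = 0 \<and> 2 * Im z = 0" by (simp only: sum_power2_le_zero_iff)
    with z(3) show False by (simp add: complex_eq_iff)
  qed
  with rec[of "z / 2"] z(1) have "d (z / 2) \<noteq> 0" by simp
  moreover have "z / 2 \<noteq> -1"
  proof
    assume "z / 2 = -1"
    then have "z = -2" by (simp add: field_simps)
    with disk[OF z(1)] show False by simp
  qed
  ultimately have "cmod z \<le> cmod (z / 2)" using z(2) by (intro min) auto
  with z(2) show False by (simp add: norm_divide)
qed

section \<open>Orders of zeros of polynomials\<close>

lemma pcompose_power: "pcompose (p ^ n) q = pcompose p q ^ n"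
  for p q :: "'a :: comm_semiring_1 poly"
  by (induction n) (simp_all add: pcompose_mult pcompose_1)

lemma order_pcompose_linear:
  fixes p :: "'a :: field poly"
  assumes "c \<noteq> 0" "p \<noteq> 0"
  shows "order x (pcompose p [:s, c:]) = order (c * x + s) p"
proof -
  define a where "a = c * x + s"
  obtain q where q: "p = [:- a, 1:] ^ order a p * q" "\<not> [:- a, 1:] dvd q"
    using order_decomp[OF assms(2)] by blast
  have "poly (pcompose q [:s, c:]) x \<noteq> 0"
    using q(2) by (simp add: poly_pcompose poly_eq_0_iff_dvd a_def algebra_simps)
  then have ord: "order x (pcompose q [:s, c:]) = 0" and "pcompose q [:s, c:] \<noteq> 0"
    by (auto simp: order_0I)
  have "pcompose [:- a, 1:] [:s, c:] = smult c [:- x, 1:]"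
    by (simp add: pcompose_pCons a_def)
  then have "pcompose p [:s, c:] = smult (c ^ order a p) ([:- x, 1:] ^ order a p * pcompose q [:s, c:])"
    by (subst q(1))
      (simp only: pcompose_mult pcompose_power mult_smult_left smult_power)
  then show ?thesis
    using \<open>c \<noteq> 0\<close> \<open>pcompose q [:s, c:] \<noteq> 0\<close> ord
    by (simp add: order_smult order_mult order_power_n_n a_def)
qed

lemma monic_complex_poly_eqI:
  fixes p q :: "complex poly"
  assumes "lead_coeff p = 1" "lead_coeff q = 1" "\<And>z. order z p = order z q"
  shows "p = q"
proof -
  have "p \<noteq> 0" "q \<noteq> 0" using assms(1,2) by auto
  then have "{z. poly p z = 0} = {z. poly q z = 0}" by (simp add: order_root assms(3))
  then show ?thesis
    using complex_poly_decompose[of p] complex_poly_decompose[of q] assms by simp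
qed

section \<open>Completely multiplicative hypergeometric sequences\<close>

text \<open>
  The assumption is \<open>R(2x) R(2x + 1) = R(x)\<close> for \<open>R = A / B\<close> with the denominators cleared.
  Comparing orders at \<open>z\<close> turns it into the recurrence of the previous lemmas, which leaves \<open>R\<close>
  with zeros and poles at \<open>0\<close> and \<open>-1\<close> only, of opposite orders.
\<close>

lemma duplication_identity_imp_power:
  fixes A B :: "complex poly"
  assumes monic: "lead_coeff A = 1" "lead_coeff B = 1"
    and dup: "pcompose A [:0, 2:] * pcompose A [:1, 2:] * B
            = pcompose B [:0, 2:] * pcompose B [:1, 2:] * A"
  obtains m :: int where
    "\<And>x. x \<noteq> 0 \<Longrightarrow> x \<noteq> -1 \<Longrightarrow> poly A x = ((x + 1) / x) powi m * poly B x"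
proof -
  have nz: "A \<noteq> 0" "B \<noteq> 0" using monic by auto
  then have nz': "pcompose A [:s, 2:] \<noteq> 0" "pcompose B [:s, 2:] \<noteq> 0" for s
    by (auto simp: pcompose_eq_0_iff)
  define d where "d z = int (order z A) - int (order z B)" for z
  have "finite {z. d z \<noteq> 0}"
  proof (rule finite_subset)
    show "{z. d z \<noteq> 0} \<subseteq> {z. poly A z = 0} \<union> {z. poly B z = 0}"
      by (auto simp: d_def order_root)
    show "finite ({z. poly A z = 0} \<union> {z. poly B z = 0})"
      using nz by (simp add: poly_roots_finite)
  qed
  moreover have rec: "d z = d (2 * z) + d (2 * z + 1)" for z
  proof -
    have "order z (pcompose A [:0, 2:] * pcompose A [:1, 2:] * B)
        = order z (pcompose B [:0, 2:] * pcompose B [:1, 2:] * A)"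
      by (simp only: dup)
    then show ?thesis
      using nz nz' by (simp add: order_mult order_pcompose_linear d_def)
  qed
  ultimately have supp: "z = 0 \<or> z = -1" if "d z \<noteq> 0" for z
    using support_of_doubling_recurrence that by blast
  have "d (-1) + d 0 = 0"
    using rec[of "- (1 / 2)"] supp[of "- (1 / 2)"] by auto
  let ?X = "[:- 0, 1:] :: complex poly" and ?Y = "[:- (- 1), 1:] :: complex poly"
  define a0 a1 b0 b1 where "a0 = order 0 A" and "a1 = order (-1) A"
    and "b0 = order 0 B" and "b1 = order (-1) B"
  \<comment> \<open>The exponents of \<open>X\<close> and \<open>X + 1\<close> in \<open>A / B\<close> are \<open>d 0\<close> and \<open>d (-1)\<close>, one of which may be
    negative; splitting each as a difference of orders gives an identity of polynomials.\<close>
  have eq: "A * (?X ^ b0 * ?Y ^ b1) = B * (?X ^ a0 * ?Y ^ a1)"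
  proof (rule monic_complex_poly_eqI)
    fix z
    have ord: "order z (P * (?X ^ k * ?Y ^ l))
        = order z P + (if z = 0 then k else 0) + (if z = -1 then l else 0)"
      if "P \<noteq> 0" for P k l
    proof -
      have "order z (?X ^ k) = (if z = 0 then k else 0)"
        using order_power_n_n[of 0 k] by (auto intro!: order_0I)
      moreover have "order z (?Y ^ l) = (if z = -1 then l else 0)"
        using order_power_n_n[of "-1" l] by (auto intro!: order_0I simp: add_eq_0_iff)
      ultimately show ?thesis using that by (simp add: order_mult)
    qed
    show "order z (A * (?X ^ b0 * ?Y ^ b1)) = order z (B * (?X ^ a0 * ?Y ^ a1))"
      unfolding ord[OF nz(1)] ord[OF nz(2)]
      using supp[of z] by (auto simp: d_def a0_def a1_def b0_def b1_def)
  qed (simp_all add: lead_coeff_mult lead_coeff_power monic)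
  define m where "m = d (-1)"
  have m: "int a1 - int b1 = m" "int a0 - int b0 = - m"
    using \<open>d (-1) + d 0 = 0\<close> by (simp_all add: m_def d_def a0_def a1_def b0_def b1_def)
  show ?thesis
  proof (rule that)
    fix x :: complex assume x: "x \<noteq> 0" "x \<noteq> -1"
    then have x1: "x + 1 \<noteq> 0" by (simp add: add_eq_0_iff2)
    have "poly A x * (x ^ b0 * (x + 1) ^ b1) = poly B x * (x ^ a0 * (x + 1) ^ a1)"
      using arg_cong[OF eq, of "\<lambda>P. poly P x"] by (simp add: add.commute)
    then have "poly A x = (x ^ a0 / x ^ b0) * ((x + 1) ^ a1 / (x + 1) ^ b1) * poly B x"
      using x(1) x1 by (simp add: field_simps)
    also have "x ^ a0 / x ^ b0 = x powi (int a0 - int b0)"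
      using x(1) by (simp add: power_int_diff)
    also have "(x + 1) ^ a1 / (x + 1) ^ b1 = (x + 1) powi (int a1 - int b1)"
      using x1 by (simp add: power_int_diff)
    also have "x powi (int a0 - int b0) * (x + 1) powi (int a1 - int b1) = ((x + 1) / x) powi m"
      by (simp add: m power_int_minus power_int_divide_distrib field_simps)
    finally show "poly A x = ((x + 1) / x) powi m * poly B x" .
  qed
qed

text \<open>
  The duplication identity for \<open>A / B\<close> is obtained at the integers \<open>n\<close> with \<open>c(n) \<noteq> 0\<close>. The powers
  of two are infinitely many such integers, so that zeros of \<open>A\<close> at positive integers, which make
  \<open>c\<close> vanish from some point on, are ruled out without a separate argument.
\<close>

lemma completely_multiplicative_hypergeometric_imp_power:
  fixes A B :: "complex poly" and c :: "nat \<Rightarrow> complex"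
  assumes monic: "lead_coeff A = 1" "lead_coeff B = 1"
    and B: "\<And>n. n \<ge> 1 \<Longrightarrow> poly B (of_nat n) \<noteq> 0"
    and A: "poly A 1 \<noteq> 0"
    and step: "\<And>n. n \<ge> 1 \<Longrightarrow> c (Suc n) * poly B (of_nat n) = c n * poly A (of_nat n)"
    and c1: "c 1 = 1"
    and mult: "completely_multiplicative c"
  obtains m :: int where "\<And>n. n \<ge> 1 \<Longrightarrow> c n = of_nat n powi m"
proof -
  have cm: "c (n * k) = c n * c k" if "n \<ge> 1" "k \<ge> 1" for n k
    using mult that by (auto simp: completely_multiplicative_def)
  have c2: "c 2 \<noteq> 0" using step[of 1] A c1 by (auto simp: numeral_2_eq_2)
  have cpow: "c (2 ^ k) \<noteq> 0" for k
    by (induction k) (use c1 c2 in \<open>auto simp: cm\<close>)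
  define L where "L = pcompose A [:0, 2:] * pcompose A [:1, 2:] * B"
  define R where "R = pcompose B [:0, 2:] * pcompose B [:1, 2:] * A"
  have eval: "poly L (of_nat n) = poly R (of_nat n)" if "n \<ge> 1" "c n \<noteq> 0" for n
  proof -
    define \<alpha> where "\<alpha> k = poly A (of_nat k)" for k :: nat
    define \<beta> where "\<beta> k = poly B (of_nat k)" for k :: nat
    have s: "c (Suc k) * \<beta> k = c k * \<alpha> k" if "k \<ge> 1" for k
      using step[OF that] by (simp add: \<alpha>_def \<beta>_def)
    have "(c 2 * c n) * (\<beta> (2 * n) * \<beta> (Suc (2 * n)) * \<alpha> n)
        = c 2 * \<beta> (2 * n) * \<beta> (Suc (2 * n)) * (c n * \<alpha> n)"
      by (simp only: mult_ac)
    also have "c n * \<alpha> n = c (Suc n) * \<beta> n" using s[OF \<open>n \<ge> 1\<close>] by simp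
    also have "c 2 * \<beta> (2 * n) * \<beta> (Suc (2 * n)) * (c (Suc n) * \<beta> n)
        = \<beta> (2 * n) * ((c 2 * c (Suc n)) * \<beta> (Suc (2 * n))) * \<beta> n"
      by (simp only: mult_ac)
    also have "c 2 * c (Suc n) = c (Suc (Suc (2 * n)))" using cm[of 2 "Suc n"] by simp
    also have "\<beta> (2 * n) * (c (Suc (Suc (2 * n))) * \<beta> (Suc (2 * n))) * \<beta> n
        = (c (Suc (2 * n)) * \<beta> (2 * n)) * \<alpha> (Suc (2 * n)) * \<beta> n"
      by (simp add: s)
    also have "\<dots> = c (2 * n) * \<alpha> (2 * n) * \<alpha> (Suc (2 * n)) * \<beta> n"
      using s[of "2 * n"] \<open>n \<ge> 1\<close> by simp
    also have "c (2 * n) = c 2 * c n" using cm[of 2 n] \<open>n \<ge> 1\<close> by simp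
    finally have "\<beta> (2 * n) * \<beta> (Suc (2 * n)) * \<alpha> n = \<alpha> (2 * n) * \<alpha> (Suc (2 * n)) * \<beta> n"
      using c2 \<open>c n \<noteq> 0\<close> by (simp add: mult.assoc)
    then show ?thesis
      by (simp add: L_def R_def poly_pcompose \<alpha>_def \<beta>_def mult.commute add.commute)
  qed
  have "L = R"
  proof (rule ccontr)
    assume "L \<noteq> R"
    then have "finite {x. poly (L - R) x = 0}" by (intro poly_roots_finite) simp
    moreover have "range (\<lambda>k. of_nat (2 ^ k)) \<subseteq> {x. poly (L - R) x = 0}"
      using eval cpow by (auto simp del: of_nat_power)
    ultimately have "finite (range (\<lambda>k. of_nat (2 ^ k) :: complex))" by (rule rev_finite_subset)
    moreover have "inj (\<lambda>k. of_nat (2 ^ k) :: complex)"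
      by (intro injI) (simp del: of_nat_power)
    ultimately show False using finite_imageD by blast
  qed
  then obtain m :: int where m:
    "\<And>x. x \<noteq> 0 \<Longrightarrow> x \<noteq> -1 \<Longrightarrow> poly A x = ((x + 1) / x) powi m * poly B x"
    using duplication_identity_imp_power[OF monic] unfolding L_def R_def by blast
  show ?thesis
  proof (rule that[of m])
    fix n :: nat assume "n \<ge> 1"
    then show "c n = of_nat n powi m"
    proof (induction n rule: nat_induct_at_least)
      case base
      show ?case using c1 by simp
    next
      case (Suc n)
      let ?n = "of_nat n :: complex"
      have n: "?n \<noteq> 0" "?n \<noteq> -1"
        using \<open>1 \<le> n\<close> of_nat_neq_0[of n] by (auto simp: eq_neg_iff_add_eq_0 add.commute)
      have "c (Suc n) * poly B ?n = (?n powi m * ((?n + 1) / ?n) powi m) * poly B ?n"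
        using step[OF Suc.hyps] m[OF n] Suc.IH by simp
      also have "?n powi m * ((?n + 1) / ?n) powi m = of_nat (Suc n) powi m"
        using n(1) by (simp flip: power_int_mult_distrib) (simp add: add.commute)
      finally show ?case using B[OF Suc.hyps] by simp
    qed
  qed
qed

section \<open>The hypergeometric coefficient\<close>

definition shifted_poly :: "nat \<Rightarrow> (nat \<Rightarrow> complex) \<Rightarrow> complex poly" where
  "shifted_poly p a = (\<Prod>i=1..p. [:a i - 1, 1:])"

lemma lead_coeff_shifted_poly: "lead_coeff (shifted_poly p a) = 1"
  by (simp add: shifted_poly_def lead_coeff_prod)

lemma prod_pochhammer_Suc:
  assumes "n \<ge> 1"
  shows "(\<Prod>i=1..p. pochhammer (a i) n)
       = (\<Prod>i=1..p. pochhammer (a i) (n - 1)) * poly (shifted_poly p a) (of_nat n)"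
proof -
  obtain k where "n = Suc k" using assms by (cases n) auto
  then show ?thesis
    by (simp add: shifted_poly_def poly_prod pochhammer_Suc prod.distrib)
qed

lemma hypergeom_coeff_step:
  assumes "n \<ge> 1" "poly (shifted_poly q b) (of_nat n) \<noteq> 0"
  shows "hypergeom_coeff p q a b (Suc n) * poly (shifted_poly q b) (of_nat n)
       = hypergeom_coeff p q a b n * poly (shifted_poly p a) (of_nat n)"
  using assms unfolding hypergeom_coeff_def diff_Suc_1
  by (simp only: prod_pochhammer_Suc) simp

theorem corollary7p2:
  fixes p q :: nat and a b :: "nat \<Rightarrow> complex"
  assumes "\<And>i. i \<in> {1..p} \<Longrightarrow> a i \<noteq> 0"
    and "\<And>j. j \<in> {1..q} \<Longrightarrow> b j \<noteq> 0"
    and "\<And>j. j \<in> {1..q} \<Longrightarrow> b j \<notin> \<int>\<^sub>\<le>\<^sub>0"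
  shows "completely_multiplicative (hypergeom_coeff p q a b) \<longleftrightarrow>
    (\<exists>(m::int) (C::complex). \<forall>n\<ge>1. hypergeom_coeff p q a b n = C * of_nat n powi m)"
proof
  let ?c = "hypergeom_coeff p q a b"
  have c1: "?c 1 = 1" by (simp add: hypergeom_coeff_def)
  {
    assume mult: "completely_multiplicative ?c"
    have B: "poly (shifted_poly q b) (of_nat n) \<noteq> 0" if "n \<ge> 1" for n
    proof -
      have "b j - 1 + of_nat n \<noteq> 0" if j: "j \<in> {1..q}" for j
      proof
        assume "b j - 1 + of_nat n = 0"
        then have "b j = - of_nat (n - 1)"
          using \<open>n \<ge> 1\<close> by (simp add: of_nat_diff algebra_simps)
        then have "b j \<in> \<int>\<^sub>\<le>\<^sub>0" by (simp del: of_nat_diff)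
        with assms(3)[OF j] show False by simp
      qed
      then show ?thesis by (auto simp: shifted_poly_def poly_prod)
    qed
    have A: "poly (shifted_poly p a) 1 \<noteq> 0"
      using assms(1) by (auto simp: shifted_poly_def poly_prod)
    obtain m where "\<And>n. n \<ge> 1 \<Longrightarrow> ?c n = of_nat n powi m"
      using completely_multiplicative_hypergeometric_imp_power
        [OF lead_coeff_shifted_poly lead_coeff_shifted_poly B A hypergeom_coeff_step[OF _ B] c1 mult]
      by blast
    then show "\<exists>m C. \<forall>n\<ge>1. ?c n = C * of_nat n powi m"
      by (intro exI[of _ m] exI[of _ 1]) simp
  }
  {
    assume "\<exists>m C. \<forall>n\<ge>1. ?c n = C * of_nat n powi m"
    then obtain m C where C: "\<And>n. n \<ge> 1 \<Longrightarrow> ?c n = C * of_nat n powi m" by blast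
    have "C = 1" using C[of 1] c1 by simp
    then show "completely_multiplicative ?c"
      by (simp add: completely_multiplicative_def C power_int_mult_distrib)
  }
qed

end
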